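(* Let $d \ge 2$ be an integer. Every $n$-element point set in general position in $\mathbb{R}^d$ has $\Omega((d+1)^n)$ peeling sequences; that is, there is a constant $c_d>0$ depending only on $d$ such that for every positive integer $n$, every set of $n$ points in general position in $\mathbb{R}^d$ has at least $c_d\,(d+1)^n$ peeling sequences. On the other hand, if $n=(d+1)^k$, where $k \in \mathbb{N}$, then there is a set of $n$ points in general position in $\mathbb{R}^d$ that has at most $(d+1)^{(d+1)n}$ peeling sequences.
   Context: $\mathbb{N}$ denotes the set of natural numbers. The dimension $d \ge 2$ is fixed. A set of points in $\mathbb{R}^d$ is in general position if any at most $d+1$ of its points are affinely independent. Let $P$ be a finite set of $n$ (labeled) points in $\mathbb{R}^d$ in general position. Consider the process that removes the points of $P$ one by one until no point remains, where in each step exactly one extreme point, i.e. one vertex of the convex hull of the set of currently remaining points, is removed. A peeling sequence of $P$ is a permutation $(p_1,\dots,p_n)$ of the points of $P$ obtained by listing the points in the order of their removal in such a process; i.e. for each $i$, $p_i$ is an extreme point of $\{p_i, p_{i+1},\dots,p_n\}$ (equivalently, $p_i \notin \mathrm{conv}\{p_{i+1},\dots,p_n\}$). *)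

theory Defs
  imports "HOL-Analysis.Analysis"
begin

definition general_position :: "(real ^ 'd) set \<Rightarrow> bool" where
  "general_position P \<longleftrightarrow>
     (\<forall>S. S \<subseteq> P \<and> finite S \<and> card S \<le> CARD('d) + 1 \<longrightarrow> \<not> affine_dependent S)"

text \<open>The points are listed in the order of their removal, so \<open>drop i xs\<close> consists of the points
  remaining just before the removal of \<open>xs ! i\<close>.\<close>

definition peeling_sequence :: "(real ^ 'd) set \<Rightarrow> (real ^ 'd) list \<Rightarrow> bool" where
  "peeling_sequence P xs \<longleftrightarrow>
     distinct xs \<and> set xs = P \<and>
     (\<forall>i < length xs. (xs ! i) extreme_point_of (convex hull (set (drop i xs))))"

text \<open>Finiteness ensures that \<open>card\<close> really counts the peeling sequences.\<close>

lemma finite_peeling_sequences: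
  fixes P :: "(real ^ 'd) set"
  assumes "finite P"
  shows "finite {xs. peeling_sequence P xs}"
proof (rule finite_subset)
  show "{xs. peeling_sequence P xs} \<subseteq> {xs. set xs \<subseteq> P \<and> length xs \<le> card P}"
    by (auto simp: peeling_sequence_def distinct_card)
  show "finite {xs. set xs \<subseteq> P \<and> length xs \<le> card P}"
    using assms by (rule finite_lists_length_le)
qed

definition num_peeling_sequences :: "(real ^ 'd) set \<Rightarrow> nat" where
  "num_peeling_sequences P = card {xs. peeling_sequence P xs}"

end

theory Submission
  imports Defs
begin

text \<open>Lower bound: as long as at least \<open>d + 1\<close> points remain, their hull is full-dimensional and thus
  has at least \<open>d + 1\<close> vertices, so every step but the last \<open>d\<close> offers \<open>d + 1\<close> choices.

  Upper bound: squeeze \<open>d + 1\<close> affine copies of the configuration on \<open>(d + 1)\<^sup>k\<close> points towards the rays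
  from the origin through the vertices of a simplex around it. While no copy is used up, a step
  can only remove the outermost point of a copy, so the copy that is used up first is
  peeled in a forced order. With \<open>n = (d + 1)\<^sup>k\<^sup>+\<^sup>1\<close> this yields \<open>f\<^sub>k\<^sub>+\<^sub>1 \<le> (d + 1)\<^sup>n f\<^sub>k\<^sup>d\<close> for the number \<open>f\<^sub>k\<close> of
  peeling sequences, hence \<open>f\<^sub>k \<le> (d + 1)^((d + 1) * (d + 1)^k)\<close>.\<close>

section \<open>The lower bound\<close>

lemma general_position_subset:
  "general_position P \<Longrightarrow> Q \<subseteq> P \<Longrightarrow> general_position Q"
  unfolding general_position_def by (meson subset_trans)

lemma peeling_sequence_Cons:
  assumes "p extreme_point_of (convex hull P)" "p \<in> P" "peeling_sequence (P - {p}) xs"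
  shows "peeling_sequence P (p # xs)"
  unfolding peeling_sequence_def
proof (intro conjI allI impI)
  have P: "set (p # xs) = P"
    using assms by (auto simp: peeling_sequence_def)
  show "set (p # xs) = P" by (rule P)
  show "distinct (p # xs)"
    using assms by (auto simp: peeling_sequence_def)
  fix i assume "i < length (p # xs)"
  then show "(p # xs) ! i extreme_point_of (convex hull (set (drop i (p # xs))))"
    using assms P by (cases i) (auto simp: peeling_sequence_def)
qed

text \<open>Prepending the removed vertex to a peeling sequence of the rest yields families that are
  disjoint, being told apart by their first entries.\<close>

lemma num_peeling_sequences_ge_sum:
  fixes P :: "(real ^ 'd) set"
  assumes "finite P"
  shows "(\<Sum>p\<in>{p. p extreme_point_of (convex hull P)}. num_peeling_sequences (P - {p}))
           \<le> num_peeling_sequences P"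
proof -
  let ?E = "{p. p extreme_point_of (convex hull P)}"
  let ?S = "\<lambda>p. (#) p ` {xs. peeling_sequence (P - {p}) xs}"
  have E: "?E \<subseteq> P" by (rule extreme_points_of_convex_hull)
  then have "finite ?E" using assms finite_subset by blast
  have "(\<Sum>p\<in>?E. num_peeling_sequences (P - {p})) = (\<Sum>p\<in>?E. card (?S p))"
    by (simp add: num_peeling_sequences_def card_image)
  also have "\<dots> = card (\<Union>p\<in>?E. ?S p)"
    using \<open>finite ?E\<close> assms
    by (intro card_UN_disjoint[symmetric]) (auto simp: finite_peeling_sequences)
  also have "\<dots> \<le> num_peeling_sequences P"
    unfolding num_peeling_sequences_def
    using E assms by (intro card_mono) (auto simp: finite_peeling_sequences peeling_sequence_Cons)
  finally show ?thesis .
qed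

text \<open>A subset of \<open>min (card P) (CARD('d) + 1)\<close> points is affinely independent
  and bounds the dimension of the hull from below. By Krein-Milman the extreme points generate the
  hull, so its dimension is less than their number.\<close>

lemma card_extreme_points_ge:
  fixes P :: "(real ^ 'd) set"
  assumes "finite P" "P \<noteq> {}" "general_position P"
  shows "min (card P) (CARD('d) + 1) \<le> card {p. p extreme_point_of (convex hull P)}"
proof -
  let ?E = "{p. p extreme_point_of (convex hull P)}"
  obtain S where S: "S \<subseteq> P" "card S = min (card P) (CARD('d) + 1)"
    using obtain_subset_with_card_n by (metis min.cobounded1)
  then have "finite S" using assms finite_subset by blast
  have "\<not> affine_dependent S"
    using assms S \<open>finite S\<close> by (auto simp: general_position_def)
  then have "int (card S) - 1 = aff_dim S"
    by (simp add: aff_dim_affine_independent)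
  also have "\<dots> \<le> aff_dim (convex hull P)"
    using S by (simp add: aff_dim_convex_hull aff_dim_subset)
  also have "convex hull P = convex hull ?E"
    using assms by (intro Krein_Milman_Minkowski) (auto simp: finite_imp_compact_convex_hull)
  also have "aff_dim (convex hull ?E) \<le> int (card ?E) - 1"
    using assms extreme_points_of_convex_hull finite_subset
    by (metis aff_dim_convex_hull aff_dim_le_card)
  finally show ?thesis using S by linarith
qed

text \<open>Each removal made while more than \<open>CARD('d)\<close> points remain contributes a
  factor \<open>CARD('d) + 1\<close>. The subtraction is truncated, so the last
  \<open>CARD('d)\<close> removals are only counted with factor 1.\<close>

lemma num_peeling_sequences_ge:
  fixes P :: "(real ^ 'd) set"
  assumes "finite P" "general_position P"
  shows "(CARD('d) + 1) ^ (card P - CARD('d)) \<le> num_peeling_sequences P"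
  using assms
proof (induction "card P" arbitrary: P)
  case 0
  then have "{xs. peeling_sequence P xs} = {[]}"
    by (auto simp: peeling_sequence_def)
  then show ?case using 0 by (simp add: num_peeling_sequences_def)
next
  case (Suc n)
  let ?E = "{p. p extreme_point_of (convex hull P)}"
  let ?b = "(CARD('d) + 1) ^ (n - CARD('d))"
  have "?b \<le> num_peeling_sequences (P - {p})" if "p \<in> ?E" for p
  proof -
    have "p \<in> P" using that extreme_points_of_convex_hull by blast
    then have "card (P - {p}) = n" using Suc by simp
    then show ?thesis
      using Suc general_position_subset[of P "P - {p}"] by (metis Diff_subset finite_Diff)
  qed
  then have "card ?E * ?b \<le> (\<Sum>p\<in>?E. num_peeling_sequences (P - {p}))"
    using sum_mono[of ?E "\<lambda>_. ?b"] by simp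
  also have "\<dots> \<le> num_peeling_sequences P"
    by (rule num_peeling_sequences_ge_sum) fact
  finally have *: "card ?E * ?b \<le> num_peeling_sequences P" .
  have "P \<noteq> {}" using Suc by auto
  then have E: "min (Suc n) (CARD('d) + 1) \<le> card ?E"
    using card_extreme_points_ge[of P] Suc by simp
  \<comment> \<open>For \<open>n < CARD('d)\<close> both exponents are 0 and one extreme point
    suffices; otherwise the exponent grows by one and the minimum is
    \<open>CARD('d) + 1\<close>.\<close>
  have "(CARD('d) + 1) ^ (Suc n - CARD('d)) \<le> min (Suc n) (CARD('d) + 1) * ?b"
  proof (cases "n < CARD('d)")
    case True
    then show ?thesis by (simp add: Suc_leI)
  next
    case False
    then show ?thesis by (simp add: Suc_diff_le)
  qed
  also have "\<dots> \<le> card ?E * ?b" using E by (rule mult_right_mono) simp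
  also note *
  finally show ?case using Suc by simp
qed

section \<open>Weak peeling sequences and perturbation\<close>

text \<open>If a point \<open>u\<close> near \<open>x' a\<close> were cut off from the moved hull by
  a hyperplane, shifting that hyperplane by \<open>r\<close> would cut off from the original hull a
  point that still lies in the ball around \<open>x a\<close>.\<close>

lemma in_interior_convex_hull_stable:
  fixes x :: "'a \<Rightarrow> 'e::euclidean_space"
  assumes "finite J" "x a \<in> interior (convex hull (x ` J))"
  obtains r where "r > 0"
    "\<And>x'. (\<And>l. l \<in> insert a J \<Longrightarrow> dist (x' l) (x l) < r) \<Longrightarrow> x' a \<in> interior (convex hull (x' ` J))"
proof -
  obtain R where R: "R > 0" "ball (x a) R \<subseteq> convex hull (x ` J)"
    using assms(2) mem_interior by metis
  have "J \<noteq> {}" using assms(2) by auto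
  \<comment> \<open>One third each for the steps from \<open>x a\<close> to \<open>x' a\<close>,
    from there to \<open>u\<close>, and from \<open>u\<close> to the point \<open>q\<close>
    below.\<close>
  define r where "r = R / 3"
  have "r > 0" using R by (simp add: r_def)
  moreover have "x' a \<in> interior (convex hull (x' ` J))"
    if d: "\<And>l. l \<in> insert a J \<Longrightarrow> dist (x' l) (x l) < r" for x'
  proof -
    have "u \<in> convex hull (x' ` J)" if u: "u \<in> ball (x' a) r" for u
    proof (rule ccontr)
      assume "u \<notin> convex hull (x' ` J)"
      moreover have "closed (convex hull (x' ` J))"
        using assms(1) by (simp add: compact_imp_closed finite_imp_compact_convex_hull)
      ultimately obtain n b where n: "n \<bullet> u < b" "\<And>y. y \<in> convex hull (x' ` J) \<Longrightarrow> b < n \<bullet> y"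
        using separating_hyperplane_closed_point[OF convex_convex_hull] by metis
      have n': "n \<bullet> u < n \<bullet> x' l" if "l \<in> J" for l
        using n(1) n(2)[of "x' l"] that by (simp add: hull_inc)
      then have "n \<noteq> 0" using \<open>J \<noteq> {}\<close> by auto
      have "x ` J \<subseteq> {y. n \<bullet> y > n \<bullet> u - r * norm n}"
      proof clarify
        fix l assume l: "l \<in> J"
        have "n \<bullet> (x' l - x l) \<le> norm n * norm (x' l - x l)" by (rule norm_cauchy_schwarz)
        also have "\<dots> \<le> norm n * r"
          using d[of l] l by (intro mult_left_mono) (auto simp: dist_norm)
        finally show "n \<bullet> x l > n \<bullet> u - r * norm n"
          using n'[OF l] by (simp add: inner_diff_right mult.commute)
      qed
      then have H: "convex hull (x ` J) \<subseteq> {y. n \<bullet> y > n \<bullet> u - r * norm n}"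
        by (rule hull_minimal) (rule convex_halfspace_gt)
      \<comment> \<open>Moving \<open>u\<close> by \<open>r\<close> against the normal reaches the
        boundary of the open half-space that contains the original hull.\<close>
      define q where "q = u - (r / norm n) *\<^sub>R n"
      have "dist (x a) q \<le> dist (x a) (x' a) + dist (x' a) u + dist u q"
        by metric
      also have "dist u q = r"
        using \<open>n \<noteq> 0\<close> \<open>r > 0\<close> by (simp add: q_def dist_norm)
      also have "dist (x a) (x' a) + dist (x' a) u + r < R"
        using d[of a] u by (simp add: r_def dist_commute)
      finally have "q \<in> convex hull (x ` J)" using R by auto
      then have "n \<bullet> q > n \<bullet> u - r * norm n" using H by blast
      moreover have "n \<bullet> q = n \<bullet> u - r * norm n"
        using \<open>n \<noteq> 0\<close> by (simp add: q_def inner_diff_right power2_norm_eq_inner[symmetric] power2_eq_square)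
      ultimately show False by simp
    qed
    then show ?thesis using \<open>r > 0\<close> mem_interior by blast
  qed
  ultimately show ?thesis using that by blast
qed

text \<open>Only finitely many pairs of a point and a subset occur, so the minimum of their radii
  serves for all of them at once.\<close>

lemma configuration_stable:
  fixes x :: "'a \<Rightarrow> 'e::euclidean_space"
  assumes "finite I"
  obtains r where "r > 0"
    "\<And>x' a J. (\<And>l. l \<in> I \<Longrightarrow> dist (x' l) (x l) < r) \<Longrightarrow> a \<in> I \<Longrightarrow> J \<subseteq> I \<Longrightarrow>
       x a \<in> interior (convex hull (x ` J)) \<Longrightarrow> x' a \<in> interior (convex hull (x' ` J))"
proof -
  define T where "T = {(a, J). a \<in> I \<and> J \<subseteq> I \<and> x a \<in> interior (convex hull (x ` J))}"
  have "T \<subseteq> I \<times> Pow I" by (auto simp: T_def)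
  then have "finite T" using assms finite_subset by blast
  have "\<exists>r>0. \<forall>x'. (\<forall>l\<in>I. dist (x' l) (x l) < r) \<longrightarrow>
          x' (fst t) \<in> interior (convex hull (x' ` snd t))" if tT: "t \<in> T" for t
  proof -
    obtain a J where t: "t = (a, J)" by force
    have aJ: "a \<in> I" "J \<subseteq> I" "x a \<in> interior (convex hull (x ` J))"
      using tT by (auto simp: T_def t)
    obtain r where r: "r > 0"
      "\<And>x'. (\<And>l. l \<in> insert a J \<Longrightarrow> dist (x' l) (x l) < r) \<Longrightarrow> x' a \<in> interior (convex hull (x' ` J))"
      using in_interior_convex_hull_stable[OF _ aJ(3)] aJ assms finite_subset by metis
    then show ?thesis using aJ unfolding t fst_conv snd_conv
      by (intro exI[of _ r]) blast
  qed
  then obtain r where r: "\<And>t. t \<in> T \<Longrightarrow> r t > 0"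
    "\<And>t x'. t \<in> T \<Longrightarrow> (\<forall>l\<in>I. dist (x' l) (x l) < r t) \<Longrightarrow>
        x' (fst t) \<in> interior (convex hull (x' ` snd t))"
    by metis
  let ?r = "Min (insert 1 (r ` T))"
  show ?thesis
  proof (rule that[of ?r])
    show "?r > 0" using r \<open>finite T\<close> by auto
    fix x' a J
    assume d: "\<And>l. l \<in> I \<Longrightarrow> dist (x' l) (x l) < ?r"
      and "a \<in> I" "J \<subseteq> I" "x a \<in> interior (convex hull (x ` J))"
    then have t: "(a, J) \<in> T" by (simp add: T_def)
    then have "?r \<le> r (a, J)" using \<open>finite T\<close> by simp
    then have "\<forall>l\<in>I. dist (x' l) (x l) < r (a, J)" using d by fastforce
    then show "x' a \<in> interior (convex hull (x' ` J))" using r(2)[OF t] by simp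
  qed
qed

text \<open>Asking only that a removed point lies outside the \<^emph>\<open>interior\<close> of the hull of its successors
  turns the failure to be such a sequence into an open condition on the points. General position can
  therefore be ignored in the construction and restored by a perturbation at the very end.\<close>

fun weakly_peels :: "('a \<Rightarrow> 'e::euclidean_space) \<Rightarrow> 'a list \<Rightarrow> bool" where
  "weakly_peels x [] \<longleftrightarrow> True"
| "weakly_peels x (a # as) \<longleftrightarrow> x a \<notin> interior (convex hull (x ` set as)) \<and> weakly_peels x as"

text \<open>Listing labels instead of points admits configurations with coinciding points, and makes
  the peelings of a configuration and of its perturbation comparable by inclusion.\<close>

definition weak_peelings :: "('a \<Rightarrow> 'e::euclidean_space) \<Rightarrow> 'a set \<Rightarrow> 'a list set" where
  "weak_peelings x I = {as. distinct as \<and> set as = I \<and> weakly_peels x as}"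

lemma finite_weak_peelings: "finite I \<Longrightarrow> finite (weak_peelings x I)"
  by (rule finite_subset[OF _ finite_lists_length_le[of I "card I"]])
     (auto simp: weak_peelings_def distinct_card)

text \<open>Dropping labels only shrinks the hulls of the successors. This restricts a weak peeling
  to a single cluster.\<close>

lemma weakly_peels_filter:
  "weakly_peels x as \<Longrightarrow> weakly_peels x (filter Q as)"
proof (induction as)
  case (Cons a as)
  have "interior (convex hull (x ` set (filter Q as))) \<subseteq> interior (convex hull (x ` set as))"
    by (intro interior_mono hull_mono image_mono) auto
  then show ?case using Cons by auto
qed simp

lemma weakly_peels_map: "weakly_peels x (map f as) \<longleftrightarrow> weakly_peels (x \<circ> f) as"
  by (induction as) (auto simp: image_comp)

lemma weakly_peels_affine:
  fixes x :: "'a \<Rightarrow> 'e::euclidean_space" and g :: "'e \<Rightarrow> 'e"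
  assumes "linear g" "inj g"
  shows "weakly_peels (\<lambda>l. c + g (x l)) as \<longleftrightarrow> weakly_peels x as"
proof (induction as)
  case (Cons a as)
  let ?S = "x ` set as"
  have "(\<lambda>l. c + g (x l)) ` set as = (+) c ` g ` ?S" by (auto simp: image_image)
  then have "interior (convex hull ((\<lambda>l. c + g (x l)) ` set as))
      = (+) c ` g ` interior (convex hull ?S)"
    using assms
    by (simp add: convex_hull_translation convex_hull_linear_image[symmetric] interior_translation
        interior_injective_linear_image)
  then show ?case using Cons assms(2) by (auto dest: injD)
qed simp

text \<open>By contraposition: containments in interiors survive the passage from \<open>x\<close>
  to \<open>x'\<close>, so \<open>x'\<close> gains no weak peeling.\<close>

lemma weakly_peels_stable:
  assumes "\<And>a J. a \<in> I \<Longrightarrow> J \<subseteq> I \<Longrightarrow>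
       x a \<in> interior (convex hull (x ` J)) \<Longrightarrow> x' a \<in> interior (convex hull (x' ` J))"
    and "set as \<subseteq> I" "weakly_peels x' as"
  shows "weakly_peels x as"
  using assms(2,3)
proof (induction as)
  case (Cons a as)
  then show ?case using assms(1)[of a "set as"] by auto
qed simp

section \<open>Restoring general position by small perturbations\<close>

lemma negligible_affine_hull_card_le:
  fixes S :: "'e::euclidean_space set"
  assumes "finite S" "card S \<le> DIM('e)"
  shows "negligible (affine hull S)"
proof -
  have "aff_dim (affine hull S) < DIM('e)"
    using aff_dim_le_card[OF assms(1)] assms(2) by simp
  then have "interior (affine hull S) = {}"
    using aff_dim_nonempty_interior by force
  then show ?thesis
    by (simp add: negligible_convex_interior affine_affine_hull affine_imp_convex)
qed

lemma exists_not_negligible_in_ball: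
  fixes z :: "'e::euclidean_space"
  assumes "negligible N" "r > 0"
  obtains y where "dist y z < r" "y \<notin> N"
proof -
  have "\<not> negligible (ball z r)" using assms(2) by (simp add: open_not_negligible)
  then have "\<not> ball z r \<subseteq> N" using assms(1) negligible_subset by blast
  then obtain y where "y \<in> ball z r" "y \<notin> N" by blast
  then show ?thesis using that[of y] by (simp add: dist_commute)
qed

text \<open>The points are moved one at a time, each avoiding the affine hulls of at most
  \<open>CARD('d)\<close> points placed before. These are finitely many null sets, so every ball
  contains an admissible position.\<close>

lemma perturb_to_general_position:
  fixes x :: "'a \<Rightarrow> real ^ 'd"
  assumes "finite I" "r > 0"
  shows "\<exists>x'. (\<forall>l\<in>I. dist (x' l) (x l) < r) \<and> inj_on x' I \<and> general_position (x' ` I)"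
  using assms(1)
proof (induction I)
  case empty
  then show ?case by (simp add: general_position_def)
next
  case (insert a I)
  then obtain x' where x': "\<And>l. l \<in> I \<Longrightarrow> dist (x' l) (x l) < r" "inj_on x' I"
    "general_position (x' ` I)" by blast
  define N where "N = \<Union> ((hull) affine ` {S. S \<subseteq> x' ` I \<and> card S \<le> CARD('d)})"
  have sub: "finite S" if "S \<subseteq> x' ` I" for S
    using insert.hyps(1) that finite_surj by blast
  have fin: "finite {S. S \<subseteq> x' ` I \<and> card S \<le> CARD('d)}"
    using insert.hyps(1) by simp
  have "negligible N"
    unfolding N_def using fin sub
    by (intro negligible_Union) (auto intro!: negligible_affine_hull_card_le)
  then obtain y where y: "dist y (x a) < r" "y \<notin> N"
    using exists_not_negligible_in_ball assms(2) by blast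
  have hull: "y \<notin> affine hull S" if "S \<subseteq> x' ` I" "card S \<le> CARD('d)" for S
    using y(2) that by (auto simp: N_def)
  have "y \<notin> x' ` I"
  proof
    assume "y \<in> x' ` I"
    then show False using hull[of "{y}"] by (simp add: Suc_leI)
  qed
  have "general_position (insert y (x' ` I))"
    unfolding general_position_def
  proof (intro allI impI, elim conjE)
    fix S assume S: "S \<subseteq> insert y (x' ` I)" "finite S" "card S \<le> CARD('d) + 1"
    show "\<not> affine_dependent S"
    proof (cases "y \<in> S")
      case True
      then have T: "S - {y} \<subseteq> x' ` I" "card (S - {y}) \<le> CARD('d)"
        using S by auto
      then have "\<not> affine_dependent (S - {y})"
        using x'(3) sub[OF T(1)] T by (simp add: general_position_def)
      then have "\<not> affine_dependent (insert y (S - {y}))"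
        using hull[OF T] by (rule affine_independent_insert)
      then show ?thesis using True by (simp add: insert_absorb)
    next
      case False
      then show ?thesis using S x'(3) by (auto simp: general_position_def)
    qed
  qed
  moreover have "x'(a := y) ` insert a I = insert y (x' ` I)"
    using insert.hyps by auto
  moreover have "inj_on (x'(a := y)) (insert a I)"
    using insert.hyps x'(2) \<open>y \<notin> x' ` I\<close> by (auto simp: inj_on_def)
  moreover have "dist ((x'(a := y)) l) (x l) < r" if "l \<in> insert a I" for l
    using that x'(1) y(1) by auto
  ultimately show ?case by metis
qed

lemma weak_peelings_general_position:
  fixes x :: "'a \<Rightarrow> real ^ 'd"
  assumes "finite I"
  obtains x' :: "'a \<Rightarrow> real ^ 'd" where "inj_on x' I" "general_position (x' ` I)"
    "weak_peelings x' I \<subseteq> weak_peelings x I"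
proof -
  obtain r where r: "r > 0"
    "\<And>x' a J. (\<And>l. l \<in> I \<Longrightarrow> dist (x' l) (x l) < r) \<Longrightarrow> a \<in> I \<Longrightarrow> J \<subseteq> I \<Longrightarrow>
       x a \<in> interior (convex hull (x ` J)) \<Longrightarrow> x' a \<in> interior (convex hull (x' ` J))"
    using configuration_stable[OF assms] by blast
  obtain x' where x': "\<And>l. l \<in> I \<Longrightarrow> dist (x' l) (x l) < r" "inj_on x' I" "general_position (x' ` I)"
    using perturb_to_general_position[OF assms r(1)] by blast
  have "weak_peelings x' I \<subseteq> weak_peelings x I"
    using weakly_peels_stable[of I x x'] r(2)[OF x'(1)] unfolding weak_peelings_def by blast
  then show ?thesis by (rule that[OF x'(2,3)])
qed

text \<open>An extreme point is not interior to the hull of all remaining points, hence not to the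
  smaller hull of its successors.\<close>

lemma weakly_peels_peeling_sequence:
  fixes xs :: "(real ^ 'd) list"
  assumes "\<And>i. i < length xs \<Longrightarrow> (xs ! i) extreme_point_of (convex hull (set (drop i xs)))"
  shows "weakly_peels (\<lambda>p. p) xs"
  using assms
proof (induction xs)
  case (Cons p xs)
  have "p extreme_point_of (convex hull (insert p (set xs)))"
    using Cons.prems[of 0] by simp
  then have "p \<notin> interior (convex hull (insert p (set xs)))"
    by (rule extreme_point_not_in_interior)
  moreover have "interior (convex hull (set xs)) \<subseteq> interior (convex hull (insert p (set xs)))"
    by (intro interior_mono hull_mono) auto
  moreover have "weakly_peels (\<lambda>p. p) xs"
    using Cons.prems[of "Suc i" for i] by (intro Cons.IH) force
  ultimately show ?case by auto
qed simp

lemma num_peeling_sequences_le_weak: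
  fixes x :: "'a \<Rightarrow> real ^ 'd"
  assumes "finite I" "inj_on x I"
  shows "num_peeling_sequences (x ` I) \<le> card (weak_peelings x I)"
proof -
  have "{xs. peeling_sequence (x ` I) xs} \<subseteq> map x ` weak_peelings x I"
  proof clarify
    fix xs assume xs: "peeling_sequence (x ` I) xs"
    define as where "as = map (inv_into I x) xs"
    have set_xs: "set xs = x ` I" and "distinct xs"
      using xs by (auto simp: peeling_sequence_def)
    have map_as: "map x as = xs"
      unfolding as_def map_map using set_xs by (intro map_idI) (simp add: f_inv_into_f)
    have "set as = I"
      using assms(2) by (auto simp: as_def set_xs)
    moreover have "distinct as"
      using \<open>distinct xs\<close> map_as distinct_map by metis
    moreover have "weakly_peels x as"
      using weakly_peels_peeling_sequence[of xs] xs weakly_peels_map[of "\<lambda>p. p" x as]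
      by (simp add: map_as peeling_sequence_def comp_def)
    ultimately show "xs \<in> map x ` weak_peelings x I"
      using map_as by (auto simp: weak_peelings_def)
  qed
  then have "num_peeling_sequences (x ` I) \<le> card (map x ` weak_peelings x I)"
    unfolding num_peeling_sequences_def using assms
    by (intro card_mono) (auto simp: finite_weak_peelings)
  also have "\<dots> \<le> card (weak_peelings x I)"
    using assms by (intro card_image_le finite_weak_peelings)
  finally show ?thesis .
qed

section \<open>Clusters along the rays of a simplex\<close>

text \<open>Otherwise some hyperplane through or beyond \<open>z\<close> has all of \<open>S\<close>
  weakly on one side. A hull without interior lies in a hyperplane, where the hypothesis for both
  normals \<open>a\<close> and \<open>- a\<close> is contradictory.\<close>

lemma in_interior_convex_hull_if_no_halfspace:
  fixes S :: "'e::euclidean_space set"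
  assumes "\<And>a. a \<noteq> 0 \<Longrightarrow> \<exists>y\<in>S. a \<bullet> y < a \<bullet> z"
  shows "z \<in> interior (convex hull S)"
proof (rule ccontr)
  assume z: "z \<notin> interior (convex hull S)"
  show False
  proof (cases "interior (convex hull S) = {}")
    case True
    then obtain a b where a: "a \<noteq> 0" "convex hull S \<subseteq> {y. a \<bullet> y = b}"
      using empty_interior_subset_hyperplane[OF convex_convex_hull] by metis
    then have eq: "a \<bullet> y = b" if "y \<in> S" for y
      using that by (meson hull_inc mem_Collect_eq subsetD)
    have "b < a \<bullet> z" using assms[OF a(1)] eq by auto
    moreover have "a \<bullet> z < b" using assms[of "- a"] a(1) eq by auto
    ultimately show False by simp
  next
    case False
    then obtain a b where a: "a \<noteq> 0" "a \<bullet> z \<le> b"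
      "\<And>y. y \<in> interior (convex hull S) \<Longrightarrow> b \<le> a \<bullet> y"
      using separating_hyperplane_sets[of "{z}" "interior (convex hull S)"] z
      by (auto simp: convex_interior)
    have "closure (interior (convex hull S)) \<subseteq> {y. a \<bullet> y \<ge> b}"
      using a(3) by (intro closure_minimal) (auto simp: closed_halfspace_ge)
    then have "closure (convex hull S) \<subseteq> {y. a \<bullet> y \<ge> b}"
      using False by (simp add: convex_closure_interior)
    then have "b \<le> a \<bullet> y" if "y \<in> S" for y
      using that closure_subset hull_inc by (metis (no_types, lifting) mem_Collect_eq subsetD)
    then show False using assms[OF a(1)] a(2) by force
  qed
qed

text \<open>The type \<open>'d option\<close> has exactly one element more than \<open>'d\<close>.
  The unit vectors and the vector with all entries -1 sum to zero, so the origin lies inside their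
  simplex.\<close>

definition simplex_vertex :: "'d option \<Rightarrow> real ^ 'd" where
  "simplex_vertex i = (case i of None \<Rightarrow> - 1 | Some j \<Rightarrow> axis j 1)"

lemma simplex_vertex_neg_inner:
  fixes a :: "real ^ 'd"
  assumes "a \<noteq> 0"
  shows "\<exists>i. a \<bullet> simplex_vertex i < 0"
proof (rule ccontr)
  assume "\<not> ?thesis"
  then have nn: "a \<bullet> simplex_vertex i \<ge> 0" for i by (meson not_le)
  have pos: "a $ j \<ge> 0" for j
    using nn[of "Some j"] by (simp add: simplex_vertex_def inner_axis)
  have "(\<Sum>j\<in>UNIV. a $ j) \<le> 0"
    using nn[of None] by (simp add: simplex_vertex_def inner_vec_def sum_negf)
  then have "(\<Sum>j\<in>UNIV. a $ j) = 0" using pos by (simp add: sum_nonneg order_antisym)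
  then have "a $ j = 0" for j using pos by (simp add: sum_nonneg_eq_0_iff)
  then show False using assms by (simp add: vec_eq_iff)
qed

text \<open>Any direction \<open>a\<close> decreases strictly towards some chosen point: the one
  further out on the same ray if \<open>a\<close> is negative there, and one on another ray
  otherwise.\<close>

lemma scaled_vertex_in_interior:
  fixes i :: "'d::finite option"
  assumes "\<And>j. s j > 0" "0 < t" "t < s i"
  shows "t *\<^sub>R simplex_vertex i \<in> interior (convex hull (range (\<lambda>j. s j *\<^sub>R simplex_vertex j)))"
proof (rule in_interior_convex_hull_if_no_halfspace)
  fix a :: "real ^ 'd" assume a: "a \<noteq> 0"
  show "\<exists>y\<in>range (\<lambda>j. s j *\<^sub>R simplex_vertex j). a \<bullet> y < a \<bullet> (t *\<^sub>R simplex_vertex i)"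
  proof (cases "a \<bullet> simplex_vertex i < 0")
    case True
    then have "s i * (a \<bullet> simplex_vertex i) < t * (a \<bullet> simplex_vertex i)"
      using assms(3) by simp
    then show ?thesis by auto
  next
    case False
    obtain j where "a \<bullet> simplex_vertex j < 0" using simplex_vertex_neg_inner[OF a] by blast
    then have "s j * (a \<bullet> simplex_vertex j) < 0" using assms(1) by (simp add: mult_pos_neg)
    also have "0 \<le> t * (a \<bullet> simplex_vertex i)" using False assms(2) by simp
    finally show ?thesis by auto
  qed
qed

text \<open>A generic \<open>w\<close> avoids the finitely many hyperplanes orthogonal to the
  differences of points of \<open>S\<close>.\<close>

lemma separating_linear_functional:
  fixes S :: "'e::euclidean_space set"
  assumes "finite S"
  obtains w where "inj_on ((\<bullet>) w) S"
proof -
  define N where "N = \<Union> ((\<lambda>(p, q). {w. (p - q) \<bullet> w = 0}) ` {(p, q). p \<in> S \<and> q \<in> S \<and> p \<noteq> q})"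
  have "{(p, q). p \<in> S \<and> q \<in> S \<and> p \<noteq> q} \<subseteq> S \<times> S" by auto
  then have "finite {(p, q). p \<in> S \<and> q \<in> S \<and> p \<noteq> q}" using assms finite_subset by blast
  then have "negligible N"
    unfolding N_def by (intro negligible_Union) (auto intro!: negligible_hyperplane)
  then obtain w where "w \<notin> N"
    using exists_not_negligible_in_ball[of N 1 0] by auto
  then have "inj_on ((\<bullet>) w) S"
    by (auto simp: N_def inj_on_def inner_diff_left inner_diff_right inner_commute)
  then show ?thesis by (rule that)
qed

text \<open>The value of \<open>first_emptied w\<close> is the letter whose last occurrence in \<open>w\<close> comes earliest; it
  is only meaningful if every element of the type occurs in \<open>w\<close>.\<close>

fun first_emptied :: "'i list \<Rightarrow> 'i" where
  "first_emptied [] = undefined"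
| "first_emptied (i # w) = (if set w = UNIV then first_emptied w else i)"

text \<open>While all clusters are inhabited, only the outermost point of each cluster can be removed.\<close>

lemma first_emptied_cluster_sorted:
  fixes x :: "'i list \<Rightarrow> 'e::euclidean_space" and h :: "'i list \<Rightarrow> real"
  assumes inner: "\<And>a b. a \<in> I \<Longrightarrow> (\<And>j. b j \<in> I \<and> hd (b j) = j) \<Longrightarrow> h a < h (b (hd a)) \<Longrightarrow>
      x a \<in> interior (convex hull (range (x \<circ> b)))"
    and "weakly_peels x as" "set as \<subseteq> I" "set (map hd as) = UNIV"
  shows "sorted (map (uminus \<circ> h) (filter (\<lambda>a. hd a = first_emptied (map hd as)) as))"
  using assms(2-)
proof (induction as)
  case (Cons a as)
  show ?case
  proof (cases "set (map hd as) = UNIV")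
    case True
    let ?i = "first_emptied (map hd as)"
    have "h a \<ge> h b" if b: "b \<in> set as" "hd b = ?i" "hd a = ?i" for b
    proof (rule ccontr)
      assume less: "\<not> h a \<ge> h b"
      have "\<exists>c. c \<in> set as \<and> hd c = j" for j
      proof -
        have "j \<in> hd ` set as" using True by simp
        then show ?thesis by auto
      qed
      then obtain c where c: "\<And>j. c j \<in> set as \<and> hd (c j) = j" by metis
      \<comment> \<open>One successor is picked from every cluster, with \<open>b\<close> for the
        cluster of \<open>a\<close>. Since \<open>b\<close> is further out, \<open>a\<close> is
        interior to their hull.\<close>
      let ?c = "c(?i := b)"
      have c': "?c j \<in> set as \<and> hd (?c j) = j" for j using c b by simp
      have cI: "?c j \<in> I \<and> hd (?c j) = j" for j
        using c'[of j] Cons.prems(2) by auto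
      have "a \<in> I" "h a < h (?c (hd a))" using Cons.prems(2) b less by auto
      then have "x a \<in> interior (convex hull (range (x \<circ> ?c)))" using cI by (intro inner)
      moreover have "interior (convex hull (range (x \<circ> ?c))) \<subseteq> interior (convex hull (x ` set as))"
        using c' by (intro interior_mono hull_mono) auto
      ultimately show False using Cons.prems by auto
    qed
    then show ?thesis using Cons True by auto
  next
    \<comment> \<open>Here \<open>a\<close> is the last point of its cluster, which is thus the
      first one emptied, and the filtered list is \<open>[a]\<close>.\<close>
    case False
    then have "hd a \<notin> set (map hd as)" using Cons.prems(3) by auto
    then have "filter (\<lambda>b. hd b = hd a) as = []" by (auto simp: filter_empty_conv image_iff)
    then show ?thesis using False by simp
  qed
qed simp

section \<open>Encoding the weak peelings of a clustered configuration\<close>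

text \<open>The word of labels tells how to interleave the sublists that belong to the single
  labels.\<close>

lemma list_eq_if_filter_eq:
  assumes "map f xs = map f ys" "\<And>i. filter (\<lambda>a. f a = i) xs = filter (\<lambda>a. f a = i) ys"
  shows "xs = ys"
  using assms
proof (induction xs arbitrary: ys)
  case (Cons a xs)
  then obtain b ys' where ys: "ys = b # ys'" "f a = f b" "map f xs = map f ys'" by auto
  have "a = b" using Cons.prems(2)[of "f a"] ys by simp
  moreover have "filter (\<lambda>a. f a = i) xs = filter (\<lambda>a. f a = i) ys'" for i
    using Cons.prems(2)[of i] ys \<open>a = b\<close> by (simp split: if_splits)
  ultimately show ?case using Cons.IH[OF ys(3)] ys by simp
qed simp

text \<open>These index the points: the first letter names the cluster, the tail the corresponding
  point of the smaller configuration.\<close>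

definition words :: "nat \<Rightarrow> 'i list set" where
  "words k = {l. length l = k}"

lemma finite_words [simp]: "finite (words k :: 'i::finite list set)"
  using finite_lists_length_eq[of "UNIV :: 'i set" k] by (simp add: words_def)

lemma card_words: "card (words k :: 'i::finite list set) = CARD('i) ^ k"
  using card_lists_length_eq[of "UNIV :: 'i set" k] by (simp add: words_def)

lemma words_Suc: "l \<in> words (Suc k) \<longleftrightarrow> l \<noteq> [] \<and> tl l \<in> words k"
  by (cases l) (auto simp: words_def)

definition cluster :: "'i \<Rightarrow> 'i list list \<Rightarrow> 'i list list" where
  "cluster i as = map tl (filter (\<lambda>a. hd a = i) as)"

lemma filter_eq_map_cluster:
  assumes "set as \<subseteq> words (Suc k)"
  shows "filter (\<lambda>a. hd a = i) as = map ((#) i) (cluster i as)"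
proof -
  have "map ((#) i) (cluster i as) = map (\<lambda>a. a) (filter (\<lambda>a. hd a = i) as)"
    unfolding cluster_def map_map
    using assms by (intro map_cong) (auto simp: words_Suc subset_iff)
  then show ?thesis by simp
qed

lemma set_cluster:
  assumes "set as = words (Suc k)"
  shows "set (cluster i as) = words k"
proof -
  have "set (cluster i as) = tl ` {a \<in> words (Suc k). hd a = i}"
    by (simp add: cluster_def assms)
  also have "{a \<in> words (Suc k). hd a = i} = (#) i ` words k"
    by (force simp: words_Suc neq_Nil_conv)
  finally show ?thesis by (simp add: image_image)
qed

lemma distinct_cluster:
  assumes "set as \<subseteq> words (Suc k)" "distinct as"
  shows "distinct (cluster i as)"
proof -
  have "distinct (map ((#) i) (cluster i as))"
    using assms(2) by (simp add: filter_eq_map_cluster[OF assms(1), symmetric])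
  then show ?thesis by (simp add: distinct_map)
qed

text \<open>A weak peeling is encoded by the word recording which cluster each removed point belongs to,
  together with the orders of removal within all clusters but the first one to be emptied.\<close>

lemma card_weak_peelings_clusters:
  fixes X :: "'i::finite list \<Rightarrow> 'e::euclidean_space" and h :: "'i list \<Rightarrow> real"
  assumes h: "inj_on h (words k)"
    and inner: "\<And>a b. a \<in> words (Suc k) \<Longrightarrow> (\<And>j. b j \<in> words (Suc k) \<and> hd (b j) = j) \<Longrightarrow>
      h (tl a) < h (tl (b (hd a))) \<Longrightarrow> X a \<in> interior (convex hull (range (X \<circ> b)))"
    and sub: "\<And>i as. weakly_peels (X \<circ> (#) i) as \<Longrightarrow> weakly_peels x as"
  shows "card (weak_peelings X (words (Suc k)))
    \<le> CARD('i) ^ (CARD('i) ^ Suc k) * card (weak_peelings x (words k)) ^ (CARD('i) - 1)"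
proof -
  let ?L = "words k :: 'i list set" and ?L' = "words (Suc k) :: 'i list set"
  let ?n = "CARD('i) ^ Suc k"
  let ?W = "weak_peelings X ?L'"
  let ?C = "\<lambda>w. - {first_emptied w} :: 'i set"
  \<comment> \<open>\<open>restrict\<close> fixes the value at the omitted cluster to
    \<open>undefined\<close>, so that the codes lie in the countable-by-factors product
    \<open>PiE\<close>.\<close>
  define code where
    "code as = (map hd as, restrict (\<lambda>i. cluster i as) (?C (map hd as)))" for as
  let ?T = "SIGMA w:words ?n. PiE (?C w) (\<lambda>_. weak_peelings x ?L)"
  have W: "set as = ?L'" "distinct as" "weakly_peels X as" if "as \<in> ?W" for as
    using that by (auto simp: weak_peelings_def)
  have sorted: "sorted (map (uminus \<circ> h) (cluster (first_emptied (map hd as)) as))"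
    if as: "as \<in> ?W" for as
  proof -
    have "\<exists>l\<in>?L'. j = hd l" for j :: 'i
      by (rule bexI[of _ "j # replicate k j"]) (auto simp: words_def)
    then have "set (map hd as) = UNIV" using W[OF as] by auto
    then have "sorted (map (uminus \<circ> (h \<circ> tl))
        (filter (\<lambda>a. hd a = first_emptied (map hd as)) as))"
      using W[OF as] inner by (intro first_emptied_cluster_sorted[where I = ?L']) auto
    then show ?thesis by (simp add: cluster_def comp_assoc)
  qed
  have "inj_on code ?W"
  proof (rule inj_onI)
    fix as bs assume as: "as \<in> ?W" and bs: "bs \<in> ?W" and eq: "code as = code bs"
    have hd_eq: "map hd as = map hd bs" using eq by (simp add: code_def)
    have "cluster i as = cluster i bs" for i
    proof (cases "i = first_emptied (map hd as)")
      case True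
      have "inj_on (uminus \<circ> h) ?L" using h by (simp add: inj_on_def)
      moreover have sets: "set (cluster i as) = ?L" "set (cluster i bs) = ?L"
        using W(1)[OF as] W(1)[OF bs] by (simp_all add: set_cluster[where k = k])
      moreover have "distinct (cluster i as)" "distinct (cluster i bs)"
        using W(1,2)[OF as] W(1,2)[OF bs] by (simp_all add: distinct_cluster[where k = k])
      \<comment> \<open>Both lists enumerate \<open>words k\<close> by decreasing \<open>h\<close>,
        which is injective there, so they agree.\<close>
      ultimately have "map (uminus \<circ> h) (cluster i as) = map (uminus \<circ> h) (cluster i bs)"
        using sorted[OF as] sorted[OF bs] True hd_eq
        by (intro sorted_distinct_set_unique) (auto simp: distinct_map)
      then show ?thesis
        using \<open>inj_on (uminus \<circ> h) ?L\<close> sets by (metis map_inj_on Un_absorb)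
    next
      case False
      have "snd (code as) i = snd (code bs) i" using eq by simp
      then show ?thesis using False hd_eq by (simp add: code_def)
    qed
    then have "filter (\<lambda>a. hd a = i) as = filter (\<lambda>a. hd a = i) bs" for i
      using W(1)[OF as] W(1)[OF bs] filter_eq_map_cluster[of as k i]
        filter_eq_map_cluster[of bs k i] by simp
    then show "as = bs" by (rule list_eq_if_filter_eq[OF hd_eq])
  qed
  moreover have "code ` ?W \<subseteq> ?T"
  proof (rule image_subsetI)
    fix as assume as: "as \<in> ?W"
    have "length as = ?n"
      using W(1,2)[OF as] card_words[of "Suc k", where 'i = 'i] distinct_card[of as]
      by simp
    then have "map hd as \<in> words ?n" by (simp add: words_def)
    moreover have "cluster i as \<in> weak_peelings x ?L" for i
    proof -
      have "weakly_peels X (filter (\<lambda>a. hd a = i) as)"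
        using W(3)[OF as] by (rule weakly_peels_filter)
      then have "weakly_peels (X \<circ> (#) i) (cluster i as)"
        using W(1)[OF as] by (simp add: filter_eq_map_cluster[of as k i] weakly_peels_map)
      then have "weakly_peels x (cluster i as)" by (rule sub)
      then show ?thesis
        using W[OF as] set_cluster[of as k i] distinct_cluster[of as k i]
        by (simp add: weak_peelings_def)
    qed
    ultimately show "code as \<in> ?T" by (simp add: code_def)
  qed
  moreover have "finite ?T"
    by (intro finite_SigmaI finite_PiE) (auto simp: finite_weak_peelings)
  ultimately have "card ?W \<le> card ?T" by (rule card_inj_on_le)
  also have "card ?T = (\<Sum>w\<in>words ?n. card (PiE (?C w) (\<lambda>_. weak_peelings x ?L)))"
    by (intro card_SigmaI) (auto intro!: finite_PiE simp: finite_weak_peelings)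
  also have "\<dots> = CARD('i) ^ ?n * card (weak_peelings x ?L) ^ (CARD('i) - 1)"
    by (simp add: card_PiE Compl_eq_Diff_UNIV card_Diff_singleton card_words)
  finally show ?thesis .
qed

section \<open>The recursive construction\<close>

text \<open>For small \<open>e\<close> this map squeezes a configuration towards the line spanned by
  \<open>u\<close>. Pairing \<open>g y\<close> with \<open>w\<close> gives
  \<open>(w \<bullet> y) * (w \<bullet> u + e)\<close>, so a kernel vector satisfies
  \<open>w \<bullet> y = 0\<close> and then vanishes.\<close>

lemma rank_one_perturbation_linear:
  fixes u w :: "'e::euclidean_space"
  assumes "e \<noteq> 0" "w \<bullet> u + e \<noteq> 0"
  defines "g \<equiv> \<lambda>y. (w \<bullet> y) *\<^sub>R u + e *\<^sub>R y"
  shows "linear g" "inj g"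
proof -
  show lin: "linear g"
    unfolding g_def by (rule linearI) (simp_all add: inner_add_right algebra_simps)
  have "y = 0" if "g y = 0" for y
  proof -
    have "w \<bullet> g y = (w \<bullet> y) * (w \<bullet> u + e)"
      by (simp add: g_def inner_add_right algebra_simps)
    then have "w \<bullet> y = 0" using that assms(2) by simp
    then show ?thesis using that assms(1) by (simp add: g_def)
  qed
  then show "inj g" using lin by (simp add: linear_injective_0)
qed

text \<open>At parameter 0 each copy collapses onto its ray, with \<open>h\<close> as position, and
  the containments needed for the encoding hold. They are open conditions, so they persist for small
  \<open>e > 0\<close>, where every cluster is an affine copy of the smaller configuration.\<close>

lemma weak_peelings_step:
  fixes x :: "'d::finite option list \<Rightarrow> real ^ 'd"
  shows "\<exists>X :: 'd option list \<Rightarrow> real ^ 'd. card (weak_peelings X (words (Suc k)))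
    \<le> (CARD('d) + 1) ^ ((CARD('d) + 1) ^ Suc k) * card (weak_peelings x (words k)) ^ CARD('d)"
proof -
  let ?L = "words k :: 'd option list set" and ?L' = "words (Suc k) :: 'd option list set"
  \<comment> \<open>Points of \<open>x\<close> may coincide; the perturbation \<open>y\<close>
    separates them without creating weak peelings, which allows an injective
    \<open>h\<close>.\<close>
  obtain y :: "'d option list \<Rightarrow> real ^ 'd"
    where y: "inj_on y ?L" "weak_peelings y ?L \<subseteq> weak_peelings x ?L"
    using weak_peelings_general_position[OF finite_words] by metis
  obtain w where w: "inj_on ((\<bullet>) w) (y ` ?L)"
    using separating_linear_functional[of "y ` ?L"] by auto
  \<comment> \<open>The shift \<open>c\<close> makes all positions \<open>h\<close> positive, as
    required for points on the rays.\<close>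
  obtain c where c: "\<And>l. l \<in> ?L \<Longrightarrow> - (w \<bullet> y l) < c"
  proof
    fix l assume l: "l \<in> ?L"
    then have "- (w \<bullet> y l) \<le> Max ((\<lambda>l. - (w \<bullet> y l)) ` ?L)" by simp
    then show "- (w \<bullet> y l) < Max ((\<lambda>l. - (w \<bullet> y l)) ` ?L) + 1" by linarith
  qed
  define h where "h l = w \<bullet> y l + c" for l
  have h_pos: "h l > 0" if "l \<in> ?L" for l using c[OF that] unfolding h_def by linarith
  have h_inj: "inj_on h ?L"
    using comp_inj_on[OF y(1) w] by (simp add: inj_on_def h_def)
  define X where "X e l = h (tl l) *\<^sub>R simplex_vertex (hd l) + e *\<^sub>R y (tl l)" for e l
  obtain r where r: "r > 0"
    "\<And>x' a J. (\<And>l. l \<in> ?L' \<Longrightarrow> dist (x' l) (X 0 l) < r) \<Longrightarrow> a \<in> ?L' \<Longrightarrow> J \<subseteq> ?L' \<Longrightarrow>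
       X 0 a \<in> interior (convex hull (X 0 ` J)) \<Longrightarrow> x' a \<in> interior (convex hull (x' ` J))"
    using configuration_stable[OF finite_words] by blast
  obtain M where M: "M > 0" "\<And>l. l \<in> ?L \<Longrightarrow> norm (y l) \<le> M"
    using finite_imp_bounded[of "y ` ?L"] by (auto simp: bounded_pos)
  \<comment> \<open>The bound \<open>r / M\<close> keeps all points within \<open>r\<close> of their
    limits on the rays; the finitely many excluded values are those for which the map of some
    cluster is not injective.\<close>
  have "infinite ({0<..<r / M} - range (\<lambda>i :: 'd option. - (w \<bullet> simplex_vertex i)))"
    using r(1) M(1) by (intro Diff_infinite_finite) (auto simp: infinite_Ioo)
  then obtain e where "e \<in> {0<..<r / M} - range (\<lambda>i :: 'd option. - (w \<bullet> simplex_vertex i))"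
    by (metis ex_in_conv finite.emptyI)
  then have e: "0 < e" "e < r / M" "\<And>i :: 'd option. e \<noteq> - (w \<bullet> simplex_vertex i)"
    by auto
  have close: "dist (X e l) (X 0 l) < r" if "l \<in> ?L'" for l
  proof -
    have "dist (X e l) (X 0 l) = e * norm (y (tl l))"
      using e(1) by (simp add: X_def dist_norm)
    also have "\<dots> \<le> e * M"
      using that e(1) M(2) words_Suc by (intro mult_left_mono) auto
    also have "\<dots> < r" using e(2) M(1) by (simp add: pos_less_divide_eq)
    finally show ?thesis .
  qed
  have "card (weak_peelings (X e) ?L')
      \<le> CARD('d option) ^ (CARD('d option) ^ Suc k) * card (weak_peelings y ?L) ^ (CARD('d option) - 1)"
  proof (rule card_weak_peelings_clusters[OF h_inj])
    fix a and b :: "'d option \<Rightarrow> 'd option list"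
    assume a: "a \<in> ?L'" and b: "\<And>j. b j \<in> ?L' \<and> hd (b j) = j"
      and less: "h (tl a) < h (tl (b (hd a)))"
    have tl: "tl l \<in> ?L" if "l \<in> ?L'" for l using that words_Suc by blast
    have "h (tl a) *\<^sub>R simplex_vertex (hd a)
        \<in> interior (convex hull (range (\<lambda>j. h (tl (b j)) *\<^sub>R simplex_vertex j)))"
      using a b less tl by (intro scaled_vertex_in_interior h_pos) auto
    then have "X 0 a \<in> interior (convex hull (X 0 ` range b))"
      using b by (simp add: X_def image_image)
    moreover have "range b \<subseteq> ?L'" using b by blast
    ultimately have "X e a \<in> interior (convex hull (X e ` range b))"
      using r(2)[OF close a] by blast
    then show "X e a \<in> interior (convex hull (range (X e \<circ> b)))"
      by (simp add: image_comp)
  next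
    fix i as assume *: "weakly_peels (X e \<circ> (#) i) as"
    let ?v = "simplex_vertex i :: real ^ 'd"
    \<comment> \<open>The shift \<open>c\<close> only contributes a translation; the remainder is
      the rank-one map plus \<open>e\<close> times the identity.\<close>
    have "X e \<circ> (#) i = (\<lambda>l. c *\<^sub>R ?v + ((w \<bullet> y l) *\<^sub>R ?v + e *\<^sub>R y l))"
      by (simp add: fun_eq_iff X_def h_def algebra_simps)
    moreover have "e \<noteq> 0" "w \<bullet> ?v + e \<noteq> 0" using e(1) e(3)[of i] by auto
    ultimately show "weakly_peels y as"
      using * weakly_peels_affine[OF rank_one_perturbation_linear[of e w ?v], of "c *\<^sub>R ?v" y as]
      by simp
  qed
  also have "\<dots> \<le> (CARD('d) + 1) ^ ((CARD('d) + 1) ^ Suc k) * card (weak_peelings x ?L) ^ CARD('d)"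
    using y(2) by (simp add: card_mono finite_weak_peelings power_mono)
  finally show ?thesis by blast
qed

text \<open>The exponent \<open>?D ^ Suc k\<close> solves the recursion: one step adds
  \<open>?D ^ Suc k\<close> to \<open>CARD('d)\<close> times itself, in total
  \<open>?D * ?D ^ Suc k\<close>.\<close>

lemma exists_few_weak_peelings:
  "\<exists>x :: 'd::finite option list \<Rightarrow> real ^ 'd.
     card (weak_peelings x (words k)) \<le> (CARD('d) + 1) ^ ((CARD('d) + 1) ^ Suc k)"
proof (induction k)
  case 0
  have "as = [[]]" if "distinct as" "set as = {[]}" for as :: "'d option list list"
    using that by (cases as; cases "tl as") auto
  then have "weak_peelings (\<lambda>_. 0 :: real ^ 'd) (words 0) \<subseteq> {[[]] :: 'd option list list}"
    by (auto simp: weak_peelings_def words_def)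
  then have "card (weak_peelings (\<lambda>_. 0 :: real ^ 'd) (words 0 :: 'd option list set)) \<le> 1"
    using card_mono[of "{[[]] :: 'd option list list}"] by simp
  also have "1 \<le> (CARD('d) + 1) ^ ((CARD('d) + 1) ^ Suc 0)" by (rule one_le_power) simp
  finally show ?case by blast
next
  case (Suc k)
  let ?D = "CARD('d) + 1"
  obtain x :: "'d option list \<Rightarrow> real ^ 'd"
    where x: "card (weak_peelings x (words k)) \<le> ?D ^ (?D ^ Suc k)" using Suc by blast
  obtain X :: "'d option list \<Rightarrow> real ^ 'd" where
    "card (weak_peelings X (words (Suc k)))
      \<le> ?D ^ (?D ^ Suc k) * card (weak_peelings x (words k)) ^ CARD('d)"
    using weak_peelings_step by blast
  also have "\<dots> \<le> ?D ^ (?D ^ Suc k) * (?D ^ (?D ^ Suc k)) ^ CARD('d)"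
    using x by (intro mult_left_mono power_mono) auto
  also have "\<dots> = ?D ^ (?D ^ Suc (Suc k))"
    by (simp add: power_mult[symmetric] power_add[symmetric] algebra_simps)
  finally show ?case by blast
qed

theorem theorem3:
  assumes "CARD('d::finite) \<ge> 2"
  shows "(\<exists>c::real. c > 0 \<and>
           (\<forall>n::nat. n \<ge> 1 \<longrightarrow>
             (\<forall>P :: (real ^ 'd) set. finite P \<and> card P = n \<and> general_position P \<longrightarrow>
               c * real (CARD('d) + 1) ^ n \<le> real (num_peeling_sequences P))))
       \<and> (\<forall>(k::nat) (n::nat). n = (CARD('d) + 1) ^ k \<longrightarrow>
           (\<exists>P :: (real ^ 'd) set. finite P \<and> card P = n \<and> general_position P \<and>
             num_peeling_sequences P \<le> (CARD('d) + 1) ^ ((CARD('d) + 1) * n)))"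
proof (intro conjI allI impI)
  let ?D = "real (CARD('d) + 1)"
  show "\<exists>c::real. c > 0 \<and>
           (\<forall>n::nat. n \<ge> 1 \<longrightarrow>
             (\<forall>P :: (real ^ 'd) set. finite P \<and> card P = n \<and> general_position P \<longrightarrow>
               c * ?D ^ n \<le> real (num_peeling_sequences P)))"
  \<comment> \<open>The constant makes up for the last \<open>CARD('d)\<close> removals, which
    contribute no factor to the lower bound.\<close>
  proof (intro exI[of _ "1 / ?D ^ CARD('d)"] conjI allI impI)
    show "0 < 1 / ?D ^ CARD('d)" by simp
    fix n :: nat and P :: "(real ^ 'd) set"
    assume P: "finite P \<and> card P = n \<and> general_position P"
    have "?D ^ n \<le> ?D ^ (CARD('d) + (n - CARD('d)))" by (intro power_increasing) auto
    then have "1 / ?D ^ CARD('d) * ?D ^ n \<le> ?D ^ (n - CARD('d))"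
      by (simp add: field_simps power_add)
    also have "\<dots> = real ((CARD('d) + 1) ^ (n - CARD('d)))" by simp
    also have "\<dots> \<le> real (num_peeling_sequences P)"
      using num_peeling_sequences_ge[of P] P by (simp only: of_nat_le_iff)
    finally show "1 / ?D ^ CARD('d) * ?D ^ n \<le> real (num_peeling_sequences P)" .
  qed
next
  fix k n :: nat assume n: "n = (CARD('d) + 1) ^ k"
  let ?L = "words k :: 'd option list set"
  obtain x :: "'d option list \<Rightarrow> real ^ 'd"
    where x: "card (weak_peelings x ?L) \<le> (CARD('d) + 1) ^ ((CARD('d) + 1) ^ Suc k)"
    using exists_few_weak_peelings by blast
  \<comment> \<open>A final perturbation turns the possibly degenerate configuration into distinct
    points in general position.\<close>
  obtain y :: "'d option list \<Rightarrow> real ^ 'd"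
    where y: "inj_on y ?L" "general_position (y ` ?L)" "weak_peelings y ?L \<subseteq> weak_peelings x ?L"
    using weak_peelings_general_position[OF finite_words] by metis
  have "num_peeling_sequences (y ` ?L) \<le> card (weak_peelings y ?L)"
    using y(1) by (simp add: num_peeling_sequences_le_weak)
  also have "\<dots> \<le> card (weak_peelings x ?L)"
    using y(3) by (simp add: card_mono finite_weak_peelings)
  also note x
  finally have "num_peeling_sequences (y ` ?L) \<le> (CARD('d) + 1) ^ ((CARD('d) + 1) * n)"
    by (simp add: n)
  moreover have "card (y ` ?L) = n"
    using y(1) by (simp add: card_image card_words n)
  ultimately show "\<exists>P :: (real ^ 'd) set. finite P \<and> card P = n \<and> general_position P \<and>
      num_peeling_sequences P \<le> (CARD('d) + 1) ^ ((CARD('d) + 1) * n)"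
    using y(2) by (intro exI[of _ "y ` ?L"]) simp
qed

end
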